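(* Let $\{X_n\}_{n\ge0}$ be a Markov chain with state space $\{1,2,3\}$ and transition matrix $P=[p_{ij}]$. The recurrence time distribution $f_{11}^{(n)}=P\{T_{11}=n\}$ of state $1$ is given by $$f_{11}^{(1)}=p_{11},\quad f_{11}^{(2)}=p_{12}p_{21}+p_{13}p_{31},\quad f_{11}^{(3)}=p_{12}p_{22}p_{21}+p_{12}p_{23}p_{31}+p_{13}p_{32}p_{21}+p_{13}p_{33}p_{31},$$ and, in general, for $n\ge3$, provided $\delta_1>0$, $$f_{11}^{(n)}=\frac{c(\lambda_{12})}{\lambda_{12}-\lambda_{13}}\lambda_{12}^{n-2}-\frac{c(\lambda_{13})}{\lambda_{12}-\lambda_{13}}\lambda_{13}^{n-2},$$ where $c(\lambda)=\det(P-\lambda I)$ is the characteristic polynomial, with $$c(\lambda_{12})=(1-p_{11})(1-p_{22})(1-p_{33})-p_{23}p_{32}(1-p_{11})-(p_{12}p_{21}+p_{13}p_{31})(1-\lambda_{12}),$$ $$c(\lambda_{13})=(1-p_{11})(1-p_{22})(1-p_{33})-p_{23}p_{32}(1-p_{11})-(p_{12}p_{21}+p_{13}p_{31})(1-\lambda_{13}),$$ and $$\lambda_{12}=\frac{p_{22}+p_{33}+\delta_1}{2},\quad \lambda_{13}=\frac{p_{22}+p_{33}-\delta_1}{2},\quad \delta_1=\sqrt{(p_{22}-p_{33})^2+4p_{23}p_{32}}.$$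
   Context: $T_{11}=\min\{n\ge1:X_n=1\}$ given $X_0=1$, so $f_{11}^{(n)}=P\{X_n=1,\ X_k\ne1\text{ for }k=1,\dots,n-1\mid X_0=1\}$. *)

theory Defs
  imports "HOL-Probability.Probability"
begin

text \<open>
  Time-homogeneous Markov chains on a finite state space, with an arbitrary initial distribution.
  The matrix is required to be stochastic on its own account, since the Markov property says
  nothing about the rows of states that the process almost surely never visits.  The positivity
  premise restricts the Markov property to histories for which the elementary conditional
  probability is meaningful.
\<close>

locale markov_chain = prob_space M
  for M :: "'a measure" +
  fixes X :: "nat \<Rightarrow> 'a \<Rightarrow> 's::finite"
    and P :: "real^'s^'s"
  assumes random_variable_X: "X n \<in> measurable M (count_space UNIV)"
    and transition_nonneg: "0 \<le> P $ i $ j"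
    and transition_row_sum: "(\<Sum>j\<in>UNIV. P $ i $ j) = 1"
    and markov_property:
      "0 < \<P>(\<omega> in M. \<forall>k\<le>n. X k \<omega> = s k) \<Longrightarrow>
        \<P>(\<omega> in M. X (Suc n) \<omega> = j \<bar> \<forall>k\<le>n. X k \<omega> = s k) = P $ s n $ j"

text \<open>The value is \<open>\<infinity>\<close> on paths that never visit \<open>i\<close> at a positive time.\<close>

definition recurrence_time :: "(nat \<Rightarrow> 'a \<Rightarrow> 's) \<Rightarrow> 's \<Rightarrow> 'a \<Rightarrow> enat" where
  "recurrence_time X i \<omega> = (INF n\<in>{n. 1 \<le> n \<and> X n \<omega> = i}. enat n)"

definition recurrence_prob :: "'a measure \<Rightarrow> (nat \<Rightarrow> 'a \<Rightarrow> 's) \<Rightarrow> 's \<Rightarrow> nat \<Rightarrow> real" where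
  "recurrence_prob M X i n = \<P>(\<omega> in M. recurrence_time X i \<omega> = enat n \<bar> X 0 \<omega> = i)"

definition char_fun :: "real^'n^'n \<Rightarrow> real \<Rightarrow> real" where
  "char_fun A x = det (A - x *\<^sub>R mat 1)"

text \<open>
  The three states are the elements \<open>1\<close>, \<open>2\<close>, \<open>3\<close> of the numeral type \<open>3\<close> (in which \<open>3 = 0\<close>).
  The numbers \<open>\<lambda>\<^sub>1\<^sub>2\<close> and \<open>\<lambda>\<^sub>1\<^sub>3\<close> are the eigenvalues of the block of \<open>P\<close> on the states \<open>2\<close>, \<open>3\<close>.
\<close>

definition delta1 :: "real^3^3 \<Rightarrow> real" where
  "delta1 P = sqrt ((P$2$2 - P$3$3)^2 + 4 * P$2$3 * P$3$2)"

definition lambda12 :: "real^3^3 \<Rightarrow> real" where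
  "lambda12 P = (P$2$2 + P$3$3 + delta1 P) / 2"

definition lambda13 :: "real^3^3 \<Rightarrow> real" where
  "lambda13 P = (P$2$2 + P$3$3 - delta1 P) / 2"

end

theory Submission
  imports Defs
begin

text \<open>
  Conditioning on the last step before the return expresses \<open>f\<^sub>1\<^sub>1\<^bsup>(n)\<^esup>\<close> as \<open>r Q\<^bsup>n-2\<^esup> s\<close>, where \<open>Q\<close> is the block of \<open>P\<close>
  on the states \<open>2\<close>, \<open>3\<close>, \<open>r = (p\<^sub>1\<^sub>2, p\<^sub>1\<^sub>3)\<close> and \<open>s = (p\<^sub>2\<^sub>1, p\<^sub>3\<^sub>1)\<^sup>T\<close>.  If \<open>\<lambda> \<noteq> \<mu>\<close> are the eigenvalues of \<open>Q\<close>, then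
  \<open>(\<lambda> - \<mu>) Q\<^sup>m = \<lambda>\<^sup>m (Q - \<mu>) - \<mu>\<^sup>m (Q - \<lambda>)\<close>, and expanding the determinant along the first row
  gives \<open>c(\<lambda>) = r (Q - \<mu>) s\<close>.
\<close>

section \<open>First-return events and taboo probabilities\<close>

text \<open>The argument \<open>n\<close> counts the intermediate states, all different from
  \<open>i\<close>, on a path from \<open>i\<close> to \<open>j\<close>; the arrival time is
  \<open>n + 1\<close>. The end state \<open>j\<close> may be \<open>i\<close> itself, which gives
  first returns.\<close>

fun taboo_prob :: "real^'s^'s \<Rightarrow> 's::finite \<Rightarrow> nat \<Rightarrow> 's \<Rightarrow> real" where
  "taboo_prob P i 0 j = P $ i $ j"
| "taboo_prob P i (Suc n) j = (\<Sum>k\<in>-{i}. taboo_prob P i n k * P $ k $ j)"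

lemma recurrence_time_eq_enat_iff:
  "recurrence_time X i \<omega> = enat (Suc n) \<longleftrightarrow> (\<forall>k\<in>{1..n}. X k \<omega> \<noteq> i) \<and> X (Suc n) \<omega> = i"
proof -
  define S where "S = {n. 1 \<le> n \<and> X n \<omega> = i}"
  have rt: "recurrence_time X i \<omega> = Inf (enat ` S)"
    by (simp add: recurrence_time_def S_def)
  show ?thesis
  proof
    assume "recurrence_time X i \<omega> = enat (Suc n)"
    with rt have eq: "Inf (enat ` S) = enat (Suc n)" by simp
    \<comment> \<open>In \<open>enat\<close> the infimum of the empty set is infinite; a finite
      value is therefore attained as a least element.\<close>
    then have "enat ` S \<noteq> {}" by (auto simp: Inf_enat_def)
    then have "Inf (enat ` S) \<in> enat ` S"
      unfolding Inf_enat_def by (auto intro: LeastI)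
    with eq have "Suc n \<in> S" by auto
    moreover have "k \<notin> S" if "k \<le> n" for k
    proof
      assume "k \<in> S"
      then have "Inf (enat ` S) \<le> enat k" by (intro Inf_lower) auto
      with eq that show False by simp
    qed
    ultimately show "(\<forall>k\<in>{1..n}. X k \<omega> \<noteq> i) \<and> X (Suc n) \<omega> = i"
      by (auto simp: S_def)
  next
    assume R: "(\<forall>k\<in>{1..n}. X k \<omega> \<noteq> i) \<and> X (Suc n) \<omega> = i"
    have "Inf (enat ` S) = enat (Suc n)"
    proof (rule antisym)
      show "Inf (enat ` S) \<le> enat (Suc n)"
        using R by (intro Inf_lower) (auto simp: S_def)
      show "enat (Suc n) \<le> Inf (enat ` S)"
      proof (rule Inf_greatest)
        fix x assume "x \<in> enat ` S"
        then obtain k where "x = enat k" "1 \<le> k" "X k \<omega> = i" by (auto simp: S_def)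
        moreover from this R have "\<not> k \<le> n" by auto
        ultimately show "enat (Suc n) \<le> x" by simp
      qed
    qed
    with rt show "recurrence_time X i \<omega> = enat (Suc n)" by simp
  qed
qed

section \<open>Path probabilities of the chain\<close>

context markov_chain
begin

lemmas [measurable] = random_variable_X

text \<open>The Markov property multiplied out. For a null history both sides vanish, so its
  positivity premise disappears.\<close>

lemma prob_path_step:
  "\<P>(\<omega> in M. (\<forall>k\<le>n. X k \<omega> = s k) \<and> X (Suc n) \<omega> = j) =
   \<P>(\<omega> in M. \<forall>k\<le>n. X k \<omega> = s k) * P $ s n $ j"
proof (cases "0 < \<P>(\<omega> in M. \<forall>k\<le>n. X k \<omega> = s k)")
  case True
  from markov_property[OF this] True show ?thesis
    by (simp add: cond_prob_def field_simps conj_commute)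
next
  case False
  then have "\<P>(\<omega> in M. \<forall>k\<le>n. X k \<omega> = s k) = 0"
    by (simp add: zero_less_measure_iff)
  moreover have "\<P>(\<omega> in M. (\<forall>k\<le>n. X k \<omega> = s k) \<and> X (Suc n) \<omega> = j)
      \<le> \<P>(\<omega> in M. \<forall>k\<le>n. X k \<omega> = s k)"
    by (intro finite_measure_mono) auto
  ultimately show ?thesis
    by (simp add: measure_le_0_iff)
qed

text \<open>The Markov property conditions on one full path. The event \<open>H\<close> is a finite
  disjoint union of such paths, and all of them contribute the same factor because they end in
  \<open>i\<close>. Restricting to \<open>{..n}\<close> makes the histories extensional, hence
  finite in number.\<close>

lemma prob_history_step:
  assumes "H \<subseteq> {..n} \<rightarrow>\<^sub>E UNIV" and "\<And>s. s \<in> H \<Longrightarrow> s n = i"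
  shows "\<P>(\<omega> in M. (\<lambda>k\<in>{..n}. X k \<omega>) \<in> H \<and> X (Suc n) \<omega> = j) =
         \<P>(\<omega> in M. (\<lambda>k\<in>{..n}. X k \<omega>) \<in> H) * P $ i $ j"
proof -
  have fin: "finite H"
    using assms(1) by (rule finite_subset) (simp add: finite_PiE)
  have path_iff: "(\<lambda>k\<in>{..n}. X k \<omega>) = s \<longleftrightarrow> (\<forall>k\<le>n. X k \<omega> = s k)" if "s \<in> H" for s \<omega>
  proof
    assume "\<forall>k\<le>n. X k \<omega> = s k"
    with that assms(1) show "(\<lambda>k\<in>{..n}. X k \<omega>) = s"
      by (intro PiE_ext[of _ "{..n}" "\<lambda>_. UNIV"]) auto
  qed auto
  have hist_iff: "(\<lambda>k\<in>{..n}. X k \<omega>) \<in> H \<longleftrightarrow> (\<exists>s\<in>H. \<forall>k\<le>n. X k \<omega> = s k)" for \<omega>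
    by (simp flip: path_iff cong: bex_cong)
  \<comment> \<open>\<open>Q\<close> is general because it serves twice: as the next-step event and
    as \<open>True\<close>.\<close>
  have decomp: "\<P>(\<omega> in M. (\<lambda>k\<in>{..n}. X k \<omega>) \<in> H \<and> Q \<omega>) =
      (\<Sum>s\<in>H. \<P>(\<omega> in M. (\<forall>k\<le>n. X k \<omega> = s k) \<and> Q \<omega>))"
    if [measurable]: "Measurable.pred M Q" for Q
  proof -
    have "{\<omega>\<in>space M. (\<lambda>k\<in>{..n}. X k \<omega>) \<in> H \<and> Q \<omega>} =
        (\<Union>s\<in>H. {\<omega>\<in>space M. (\<forall>k\<le>n. X k \<omega> = s k) \<and> Q \<omega>})"
      unfolding hist_iff by auto
    also have "prob \<dots> = (\<Sum>s\<in>H. \<P>(\<omega> in M. (\<forall>k\<le>n. X k \<omega> = s k) \<and> Q \<omega>))"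
    proof (rule finite_measure_finite_Union[OF fin])
      show "disjoint_family_on (\<lambda>s. {\<omega>\<in>space M. (\<forall>k\<le>n. X k \<omega> = s k) \<and> Q \<omega>}) H"
      proof (unfold disjoint_family_on_def, intro ballI impI)
        fix s t assume "s \<in> H" "t \<in> H" "s \<noteq> t"
        then have "\<not> ((\<forall>k\<le>n. X k \<omega> = s k) \<and> (\<forall>k\<le>n. X k \<omega> = t k))" for \<omega>
          by (auto simp flip: path_iff)
        then show "{\<omega>\<in>space M. (\<forall>k\<le>n. X k \<omega> = s k) \<and> Q \<omega>} \<inter>
            {\<omega>\<in>space M. (\<forall>k\<le>n. X k \<omega> = t k) \<and> Q \<omega>} = {}"
          by auto
      qed
      show "(\<lambda>s. {\<omega>\<in>space M. (\<forall>k\<le>n. X k \<omega> = s k) \<and> Q \<omega>}) ` H \<subseteq> events"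
        by (intro image_subsetI) measurable
    qed
    finally show ?thesis .
  qed
  have "\<P>(\<omega> in M. (\<lambda>k\<in>{..n}. X k \<omega>) \<in> H \<and> X (Suc n) \<omega> = j) =
      (\<Sum>s\<in>H. \<P>(\<omega> in M. \<forall>k\<le>n. X k \<omega> = s k) * P $ i $ j)"
    by (subst decomp, measurable) (simp add: prob_path_step assms(2) cong: sum.cong)
  also have "\<dots> = \<P>(\<omega> in M. (\<lambda>k\<in>{..n}. X k \<omega>) \<in> H) * P $ i $ j"
    using decomp[of "\<lambda>_. True"] by (simp add: sum_distrib_right)
  finally show ?thesis .
qed

text \<open>Induction on \<open>n\<close>, splitting by the state \<open>k\<close> at time
  \<open>n + 1\<close>, which must differ from \<open>i\<close>. The product form avoids dividing by
  the probability of the initial state.\<close>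

lemma prob_taboo:
  "\<P>(\<omega> in M. X 0 \<omega> = i \<and> (\<forall>k\<in>{1..n}. X k \<omega> \<noteq> i) \<and> X (Suc n) \<omega> = j) =
   \<P>(\<omega> in M. X 0 \<omega> = i) * taboo_prob P i n j"
proof (induction n arbitrary: j)
  case 0
  show ?case
    using prob_path_step[of 0 "\<lambda>_. i" j] by simp
next
  case (Suc n)
  have "{\<omega>\<in>space M. X 0 \<omega> = i \<and> (\<forall>k\<in>{1..Suc n}. X k \<omega> \<noteq> i) \<and> X (Suc (Suc n)) \<omega> = j} =
      (\<Union>k\<in>-{i}. {\<omega>\<in>space M. (X 0 \<omega> = i \<and> (\<forall>k\<in>{1..n}. X k \<omega> \<noteq> i) \<and> X (Suc n) \<omega> = k)
         \<and> X (Suc (Suc n)) \<omega> = j})"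
    by (auto simp: atLeastAtMostSuc_conv)
  also have "prob \<dots> = (\<Sum>k\<in>-{i}. \<P>(\<omega> in M. (X 0 \<omega> = i \<and> (\<forall>k\<in>{1..n}. X k \<omega> \<noteq> i)
      \<and> X (Suc n) \<omega> = k) \<and> X (Suc (Suc n)) \<omega> = j))"
    by (rule finite_measure_finite_Union) (auto simp: disjoint_family_on_def)
  also have "\<dots> = (\<Sum>k\<in>-{i}. \<P>(\<omega> in M. X 0 \<omega> = i) * taboo_prob P i n k * P $ k $ j)"
  proof (rule sum.cong[OF refl])
    fix k
    \<comment> \<open>The taboo event is recoded as a set of paths with last state \<open>k\<close>,
      as \<open>prob_history_step\<close> requires.\<close>
    define H where "H = {s \<in> {..Suc n} \<rightarrow>\<^sub>E UNIV. s 0 = i \<and> (\<forall>k\<in>{1..n}. s k \<noteq> i) \<and> s (Suc n) = k}"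
    have hist_iff: "(X 0 \<omega> = i \<and> (\<forall>k\<in>{1..n}. X k \<omega> \<noteq> i) \<and> X (Suc n) \<omega> = k) \<longleftrightarrow>
        (\<lambda>k\<in>{..Suc n}. X k \<omega>) \<in> H" for \<omega>
      by (auto simp: H_def)
    have "\<P>(\<omega> in M. (\<lambda>k\<in>{..Suc n}. X k \<omega>) \<in> H \<and> X (Suc (Suc n)) \<omega> = j) =
        \<P>(\<omega> in M. (\<lambda>k\<in>{..Suc n}. X k \<omega>) \<in> H) * P $ k $ j"
      by (rule prob_history_step) (auto simp: H_def)
    also have "\<P>(\<omega> in M. (\<lambda>k\<in>{..Suc n}. X k \<omega>) \<in> H) = \<P>(\<omega> in M. X 0 \<omega> = i) * taboo_prob P i n k"
      using Suc.IH[of k] unfolding hist_iff .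
    finally show "\<P>(\<omega> in M. (X 0 \<omega> = i \<and> (\<forall>k\<in>{1..n}. X k \<omega> \<noteq> i) \<and> X (Suc n) \<omega> = k)
        \<and> X (Suc (Suc n)) \<omega> = j) = \<P>(\<omega> in M. X 0 \<omega> = i) * taboo_prob P i n k * P $ k $ j"
      unfolding hist_iff .
  qed
  finally show ?case
    by (simp add: sum_distrib_left mult.assoc)
qed

lemma recurrence_prob_Suc:
  assumes "0 < \<P>(\<omega> in M. X 0 \<omega> = i)"
  shows "recurrence_prob M X i (Suc n) = taboo_prob P i n i"
proof -
  have "{\<omega>\<in>space M. recurrence_time X i \<omega> = enat (Suc n) \<and> X 0 \<omega> = i} =
      {\<omega>\<in>space M. X 0 \<omega> = i \<and> (\<forall>k\<in>{1..n}. X k \<omega> \<noteq> i) \<and> X (Suc n) \<omega> = i}"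
    by (auto simp: recurrence_time_eq_enat_iff)
  with assms prob_taboo[of i n i] show ?thesis
    by (simp add: recurrence_prob_def cond_prob_def)
qed

end

section \<open>Algebra of the block on the states 2 and 3\<close>

lemma Compl_one_3: "-{1::3} = {2, 3}"
  using exhaust_3 by auto

lemma taboo_prob_one_Suc:
  fixes P :: "real^3^3"
  shows "taboo_prob P 1 (Suc n) j = taboo_prob P 1 n 2 * P$2$j + taboo_prob P 1 n 3 * P$3$j"
  by (simp add: Compl_one_3)

lemma lambda_sum: "lambda12 P + lambda13 P = P$2$2 + P$3$3"
  by (simp add: lambda12_def lambda13_def field_simps)

lemma lambda_diff: "lambda12 P - lambda13 P = delta1 P"
  by (simp add: lambda12_def lambda13_def field_simps)

text \<open>The assumption makes the radicand of \<open>delta1\<close> nonnegative, so squaring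
  undoes the root. Sum and product are the trace and determinant of the block, and later lemmas use
  only these two relations.\<close>

lemma lambda_prod:
  assumes "0 \<le> P$2$3 * P$3$2"
  shows "lambda12 P * lambda13 P = P$2$2 * P$3$3 - P$2$3 * P$3$2"
proof -
  have "delta1 P ^ 2 = (P$2$2 - P$3$3)^2 + 4 * P$2$3 * P$3$2"
    using assms by (simp add: delta1_def mult.assoc)
  then show ?thesis
    by (simp add: lambda12_def lambda13_def field_simps power2_eq_square)
qed

text \<open>\<open>r (Q - \<mu>)\<close> is a left eigenvector of \<open>Q\<close> for the eigenvalue \<open>\<lambda>\<close>.\<close>

lemma block_left_eigenvector:
  fixes P :: "real^3^3"
  assumes sum: "l + m = P$2$2 + P$3$3" and prod: "l * m = P$2$2 * P$3$3 - P$2$3 * P$3$2"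
  defines "u \<equiv> P$1$2 * (P$2$2 - m) + P$1$3 * P$3$2"
    and "v \<equiv> P$1$2 * P$2$3 + P$1$3 * (P$3$3 - m)"
  shows "u * P$2$2 + v * P$3$2 = l * u" and "u * P$2$3 + v * P$3$3 = l * v"
  unfolding u_def v_def using sum prod by algebra+

text \<open>The two left sides form the row vector \<open>(l - m) r Q^n\<close>. At
  \<open>n = 0\<close> it is the difference of \<open>r (Q - m)\<close> and
  \<open>r (Q - l)\<close>; these are left eigenvectors, so each step multiplies them by
  \<open>l\<close> and \<open>m\<close> respectively.\<close>

lemma taboo_prob_one_closed_form:
  fixes P :: "real^3^3"
  assumes sum: "l + m = P$2$2 + P$3$3" and prod: "l * m = P$2$2 * P$3$3 - P$2$3 * P$3$2"
  shows "(l - m) * taboo_prob P 1 n 2 =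
      l ^ n * (P$1$2 * (P$2$2 - m) + P$1$3 * P$3$2) - m ^ n * (P$1$2 * (P$2$2 - l) + P$1$3 * P$3$2)"
    (is "_ = _ * ?ul - _ * ?um")
    and "(l - m) * taboo_prob P 1 n 3 =
      l ^ n * (P$1$2 * P$2$3 + P$1$3 * (P$3$3 - m)) - m ^ n * (P$1$2 * P$2$3 + P$1$3 * (P$3$3 - l))"
    (is "_ = _ * ?vl - _ * ?vm")
proof (induction n)
  case 0
  show "(l - m) * taboo_prob P 1 0 2 = l ^ 0 * ?ul - m ^ 0 * ?um"
    by (simp add: algebra_simps)
  show "(l - m) * taboo_prob P 1 0 3 = l ^ 0 * ?vl - m ^ 0 * ?vm"
    by (simp add: algebra_simps)
next
  case (Suc n)
  \<comment> \<open>The hypotheses are symmetric in the two eigenvalues; the swapped form handles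
    the second vector.\<close>
  have sum': "m + l = P$2$2 + P$3$3" and prod': "m * l = P$2$2 * P$3$3 - P$2$3 * P$3$2"
    using sum prod by (simp_all add: ac_simps)
  have step: "(l - m) * taboo_prob P 1 (Suc n) j =
      l ^ n * (?ul * P$2$j + ?vl * P$3$j) - m ^ n * (?um * P$2$j + ?vm * P$3$j)" for j
  proof -
    have "(l - m) * taboo_prob P 1 (Suc n) j =
        ((l - m) * taboo_prob P 1 n 2) * P$2$j + ((l - m) * taboo_prob P 1 n 3) * P$3$j"
      by (simp only: taboo_prob_one_Suc distrib_left mult.assoc)
    then show ?thesis
      unfolding Suc.IH by (simp only: left_diff_distrib distrib_left mult.assoc diff_conv_add_uminus
          minus_add_distrib mult_minus_left mult_minus_right ac_simps)
  qed
  show "(l - m) * taboo_prob P 1 (Suc n) 2 = l ^ Suc n * ?ul - m ^ Suc n * ?um"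
    unfolding step block_left_eigenvector(1)[OF sum prod] block_left_eigenvector(1)[OF sum' prod']
    by (simp only: power_Suc ac_simps)
  show "(l - m) * taboo_prob P 1 (Suc n) 3 = l ^ Suc n * ?vl - m ^ Suc n * ?vm"
    unfolding step block_left_eigenvector(2)[OF sum prod] block_left_eigenvector(2)[OF sum' prod']
    by (simp only: power_Suc ac_simps)
qed

lemma char_fun_3:
  fixes P :: "real^3^3"
  shows "char_fun P x = (P$1$1 - x) * ((P$2$2 - x) * (P$3$3 - x) - P$2$3 * P$3$2)
    - P$1$2 * (P$2$1 * (P$3$3 - x) - P$2$3 * P$3$1)
    + P$1$3 * (P$2$1 * P$3$2 - (P$2$2 - x) * P$3$1)"
  by (simp add: char_fun_def det_3 mat_def) (simp add: algebra_simps)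

text \<open>The cofactor of the first diagonal entry is \<open>det (Q - l) = 0\<close>. The rest of
  the expansion is \<open>- r adj(Q - l) s\<close>, and the adjugate equals \<open>m - Q\<close>
  since \<open>l + m\<close> is the trace.\<close>

lemma char_fun_block_eigenvalue:
  fixes P :: "real^3^3"
  assumes "l + m = P$2$2 + P$3$3" and "l * m = P$2$2 * P$3$3 - P$2$3 * P$3$2"
  shows "char_fun P l = (P$1$2 * (P$2$2 - m) + P$1$3 * P$3$2) * P$2$1
    + (P$1$2 * P$2$3 + P$1$3 * (P$3$3 - m)) * P$3$1"
  using assms unfolding char_fun_3 by algebra

text \<open>Subtracting \<open>c(1)\<close>, which is \<open>0\<close> for row sums \<open>1\<close>, brings in the terms in \<open>1 - p\<^sub>i\<^sub>i\<close>.\<close>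

lemma char_fun_block_eigenvalue_stochastic:
  fixes P :: "real^3^3"
  assumes "l + m = P$2$2 + P$3$3" and "l * m = P$2$2 * P$3$3 - P$2$3 * P$3$2"
    and rows: "\<And>i. (\<Sum>j\<in>UNIV. P $ i $ j) = 1"
  shows "char_fun P l = (1 - P$1$1) * (1 - P$2$2) * (1 - P$3$3) - P$2$3 * P$3$2 * (1 - P$1$1)
    - (P$1$2 * P$2$1 + P$1$3 * P$3$1) * (1 - l)"
proof -
  have "P$1$1 = 1 - P$1$2 - P$1$3" "P$2$1 = 1 - P$2$2 - P$2$3" "P$3$1 = 1 - P$3$2 - P$3$3"
    using rows[of 1] rows[of 2] rows[of 3] by (simp_all add: sum_3)
  then have "char_fun P 1 = 0"
    unfolding char_fun_3 by algebra
  \<comment> \<open>In \<open>c(l) - c(1)\<close> the terms through three distinct states cancel,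
    and the block determinant vanishes at \<open>l\<close> but survives at 1, with factor
    \<open>1 - p11\<close>.\<close>
  with assms(1,2) show ?thesis
    unfolding char_fun_3 by algebra
qed

theorem theorem4p1:
  fixes M :: "'a measure" and X :: "nat \<Rightarrow> 'a \<Rightarrow> 3" and P :: "real^3^3"
  assumes "markov_chain M X P"
    and "0 < \<P>(\<omega> in M. X 0 \<omega> = 1)"
  shows "recurrence_prob M X 1 1 = P$1$1 \<and>
         recurrence_prob M X 1 2 = P$1$2 * P$2$1 + P$1$3 * P$3$1 \<and>
         recurrence_prob M X 1 3 =
           P$1$2 * P$2$2 * P$2$1 + P$1$2 * P$2$3 * P$3$1
         + P$1$3 * P$3$2 * P$2$1 + P$1$3 * P$3$3 * P$3$1 \<and>
         (\<forall>n\<ge>3. 0 < delta1 P \<longrightarrow>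
           recurrence_prob M X 1 n =
             char_fun P (lambda12 P) / (lambda12 P - lambda13 P) * lambda12 P ^ (n - 2)
           - char_fun P (lambda13 P) / (lambda12 P - lambda13 P) * lambda13 P ^ (n - 2)) \<and>
         char_fun P (lambda12 P) =
             (1 - P$1$1) * (1 - P$2$2) * (1 - P$3$3) - P$2$3 * P$3$2 * (1 - P$1$1)
           - (P$1$2 * P$2$1 + P$1$3 * P$3$1) * (1 - lambda12 P) \<and>
         char_fun P (lambda13 P) =
             (1 - P$1$1) * (1 - P$2$2) * (1 - P$3$3) - P$2$3 * P$3$2 * (1 - P$1$1)
           - (P$1$2 * P$2$1 + P$1$3 * P$3$1) * (1 - lambda13 P)"
proof -
  interpret markov_chain M X P by (rule assms(1))
  let ?l = "lambda12 P" and ?m = "lambda13 P"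
  note rec = recurrence_prob_Suc[OF assms(2)]
  have sum: "?l + ?m = P$2$2 + P$3$3"
    by (rule lambda_sum)
  have prod: "?l * ?m = P$2$2 * P$3$3 - P$2$3 * P$3$2"
    by (intro lambda_prod mult_nonneg_nonneg transition_nonneg)
  have sum': "?m + ?l = P$2$2 + P$3$3" and prod': "?m * ?l = P$2$2 * P$3$3 - P$2$3 * P$3$2"
    using sum prod by (simp_all add: ac_simps)
  have f1: "recurrence_prob M X 1 1 = P$1$1"
    using rec[of 0] by simp
  have f2: "recurrence_prob M X 1 2 = P$1$2 * P$2$1 + P$1$3 * P$3$1"
    using rec[of 1] by (simp add: numeral_2_eq_2 Compl_one_3)
  have f3: "recurrence_prob M X 1 3 = P$1$2 * P$2$2 * P$2$1 + P$1$2 * P$2$3 * P$3$1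
      + P$1$3 * P$3$2 * P$2$1 + P$1$3 * P$3$3 * P$3$1"
    using rec[of 2] by (simp add: numeral_3_eq_3 numeral_2_eq_2 Compl_one_3 algebra_simps)
  have fn: "recurrence_prob M X 1 n = char_fun P ?l / (?l - ?m) * ?l ^ (n - 2)
      - char_fun P ?m / (?l - ?m) * ?m ^ (n - 2)" if "3 \<le> n" "0 < delta1 P" for n
  proof -
    \<comment> \<open>One step is the final move into state 1 and one is absorbed by the index shift
      of \<open>taboo_prob\<close>; hence the exponent \<open>n - 2\<close>.\<close>
    define k where "k = n - 2"
    have n: "n = Suc (Suc k)" using that(1) by (simp add: k_def)
    have "(?l - ?m) * recurrence_prob M X 1 n =
        ((?l - ?m) * taboo_prob P 1 k 2) * P$2$1 + ((?l - ?m) * taboo_prob P 1 k 3) * P$3$1"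
      by (simp only: n rec taboo_prob_one_Suc) (simp add: algebra_simps)
    also have "\<dots> = char_fun P ?l * ?l ^ k - char_fun P ?m * ?m ^ k"
      unfolding taboo_prob_one_closed_form[OF sum prod]
        char_fun_block_eigenvalue[OF sum prod] char_fun_block_eigenvalue[OF sum' prod']
      by (simp add: algebra_simps)
    finally have "(?l - ?m) * recurrence_prob M X 1 n =
        char_fun P ?l * ?l ^ k - char_fun P ?m * ?m ^ k" .
    moreover have "?l - ?m \<noteq> 0" using that(2) by (simp add: lambda_diff)
    ultimately show ?thesis
      unfolding k_def by (simp add: divide_simps mult.commute)
  qed
  from f1 f2 f3 fn char_fun_block_eigenvalue_stochastic[OF sum prod transition_row_sum]
    char_fun_block_eigenvalue_stochastic[OF sum' prod' transition_row_sum]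
  show ?thesis by blast
qed

end
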